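(* Let $n\ge 3$ be an integer and let $G_n=(X_n,\omega_{G_n})$ be the cycle network of length $n$. Then $$\mathrm{Dgm}_1^{\mathfrak D}(G_n)=\{(1,\lceil n/2\rceil)\}\subseteq\mathbb R^2,$$ i.e. $\mathrm{Dgm}_1^{\mathfrak D}(G_n)$ consists of precisely the point $(1,\lceil n/2\rceil)$ with multiplicity $1$.
   Context: The cycle network $G_n=(X_n,\omega_{G_n})$ has node set $X_n=\{x_1,\dots,x_n\}$, and $\omega_{G_n}(x,x')$ is the shortest (directed) path distance in the directed graph with edges $(x_1,x_2),(x_2,x_3),\dots,(x_{n-1},x_n),(x_n,x_1)$, each of weight $1$ (so $\omega_{G_n}(x_i,x_j)$ is the representative of $j-i$ modulo $n$ in $\{0,\dots,n-1\}$). For a finite set $X$ with weight function $\omega_X:X\times X\to\mathbb R$ and $\delta\in\mathbb R$, the Dowker $\delta$-sink complex $\mathfrak D^{\mathrm{si}}_{\delta,X}$ consists of all nonempty $\sigma\subseteq X$ for which there is $x'\in X$ with $\omega_X(x,x')\le\delta$ for all $x\in\sigma$; these form a filtration in $\delta$. Fix a field $\mathbb K$. $\mathrm{Dgm}_k^{\mathfrak D}(X)$, the $k$-dimensional Dowker persistence diagram, is the persistence diagram of the persistence vector space obtained by applying $H_k(\cdot;\mathbb K)$ to this filtration (the source filtration, defined with $\omega_X(x',x)\le\delta$ instead, gives the same diagram), i.e. the multiset of points $(a,b)$, $a<b$, one for each interval $[a,b)$ in its decomposition into interval modules. *)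

theory Defs
  imports
    "HOL-Library.Multiset"
    "HOL-Library.Extended_Real"
    "HOL-Algebra.Module"
    "HOL-Algebra.AbelCoset"
begin

section \<open>Persistence vector spaces\<close>

text \<open>
  The coefficient field is a type \<open>'k\<close> of class \<^class>\<open>field\<close>.  Vector spaces over it are
  \<^typ>\<open>('k, 'v) module\<close> records; the fields \<^const>\<open>mult\<close> and \<^const>\<open>one\<close> inherited from rings
  play no role and are left \<^const>\<open>undefined\<close>.  The map \<open>transition V s t\<close> is the structure map from
  \<open>level V s\<close> to \<open>level V t\<close>; it is meaningful only for \<open>s \<le> t\<close> and on the carrier of \<open>level V s\<close>.
\<close>

record ('k, 'v) pvs =
  level :: "real \<Rightarrow> ('k, 'v) module"
  transition :: "real \<Rightarrow> real \<Rightarrow> 'v \<Rightarrow> 'v"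

definition linear_iso :: "('k, 'v) module \<Rightarrow> ('k, 'w) module \<Rightarrow> ('v \<Rightarrow> 'w) \<Rightarrow> bool" where
  "linear_iso V W f \<longleftrightarrow>
     bij_betw f (carrier V) (carrier W) \<and>
     (\<forall>x \<in> carrier V. \<forall>y \<in> carrier V. f (x \<oplus>\<^bsub>V\<^esub> y) = f x \<oplus>\<^bsub>W\<^esub> f y) \<and>
     (\<forall>c. \<forall>x \<in> carrier V. f (c \<odot>\<^bsub>V\<^esub> x) = c \<odot>\<^bsub>W\<^esub> f x)"

definition pvs_isomorphic :: "('k, 'v) pvs \<Rightarrow> ('k, 'w) pvs \<Rightarrow> bool" where
  "pvs_isomorphic V W \<longleftrightarrow>
     (\<exists>\<phi>. (\<forall>\<delta>. linear_iso (level V \<delta>) (level W \<delta>) (\<phi> \<delta>)) \<and>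
          (\<forall>s t. s \<le> t \<longrightarrow>
             (\<forall>x \<in> carrier (level V s). \<phi> t (transition V s t x) = transition W s t (\<phi> s x))))"

text \<open>The interval module of \<open>[a, b)\<close>, where \<open>b = \<infinity>\<close> is allowed.\<close>

definition interval_module :: "real \<times> ereal \<Rightarrow> ('k::field, 'k) pvs" where
  "interval_module I =
     (let inside = (\<lambda>\<delta>. fst I \<le> \<delta> \<and> ereal \<delta> < snd I) in
      \<lparr>level = (\<lambda>\<delta>. \<lparr>carrier = (if inside \<delta> then UNIV else {0}),
                    mult = undefined, one = undefined,
                    zero = 0, add = (+), smult = (*)\<rparr>),
       transition = (\<lambda>s t x. if inside s \<and> inside t then x else 0)\<rparr>)"

definition direct_sum :: "('k, 'v) pvs list \<Rightarrow> ('k, nat \<Rightarrow> 'v) pvs" where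
  "direct_sum Vs =
     \<lparr>level = (\<lambda>\<delta>. \<lparr>carrier = (\<Pi>\<^sub>E i \<in> {..<length Vs}. carrier (level (Vs ! i) \<delta>)),
                   mult = undefined, one = undefined,
                   zero = (\<lambda>i \<in> {..<length Vs}. \<zero>\<^bsub>level (Vs ! i) \<delta>\<^esub>),
                   add = (\<lambda>f g. \<lambda>i \<in> {..<length Vs}. f i \<oplus>\<^bsub>level (Vs ! i) \<delta>\<^esub> g i),
                   smult = (\<lambda>c f. \<lambda>i \<in> {..<length Vs}. c \<odot>\<^bsub>level (Vs ! i) \<delta>\<^esub> f i)\<rparr>),
      transition = (\<lambda>s t f. \<lambda>i \<in> {..<length Vs}. transition (Vs ! i) s t (f i))\<rparr>"

text \<open>
  \<open>D\<close> is the persistence diagram of \<open>V\<close>: the multiset of endpoint pairs of the intervals in a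
  decomposition of \<open>V\<close> into (finitely many, half-open) interval modules.
\<close>

definition has_persistence_diagram ::
    "('k::field, 'v) pvs \<Rightarrow> (real \<times> ereal) multiset \<Rightarrow> bool" where
  "has_persistence_diagram V D \<longleftrightarrow>
     (\<exists>Is. mset Is = D \<and> (\<forall>(a, b) \<in> set Is. ereal a < b) \<and>
           pvs_isomorphic V (direct_sum (map interval_module Is)))"


section \<open>Simplicial homology over a field\<close>

text \<open>
  A simplicial complex is given by its set of nonempty finite simplices.  A simplex is oriented by
  the order of the vertex type, so that chains are finitely supported functions on simplices; the
  exponent of the sign in the boundary is the position of the removed vertex \<open>v\<close> in \<open>\<sigma>\<close>.
  Homology is unreduced: the boundary of a \<open>0\<close>-chain is \<open>0\<close>.
\<close>

definition chain_space :: "'a set set \<Rightarrow> nat \<Rightarrow> ('k::field, 'a set \<Rightarrow> 'k) module" where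
  "chain_space S k =
     \<lparr>carrier = {c. finite {\<sigma>. c \<sigma> \<noteq> 0} \<and> {\<sigma>. c \<sigma> \<noteq> 0} \<subseteq> {\<sigma> \<in> S. card \<sigma> = k + 1}},
      mult = undefined, one = undefined,
      zero = (\<lambda>\<sigma>. 0),
      add = (\<lambda>c d \<sigma>. c \<sigma> + d \<sigma>),
      smult = (\<lambda>a c \<sigma>. a * c \<sigma>)\<rparr>"

definition boundary :: "nat \<Rightarrow> ('a::linorder set \<Rightarrow> 'k::field) \<Rightarrow> ('a set \<Rightarrow> 'k)" where
  "boundary k c = (\<lambda>\<tau>. if k = 0 then 0 else
     (\<Sum>\<sigma> | c \<sigma> \<noteq> 0. \<Sum>v \<in> \<sigma>.
        if \<tau> = \<sigma> - {v} then (-1) ^ card {u \<in> \<sigma>. u < v} * c \<sigma> else 0))"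

definition cycle_space :: "'a::linorder set set \<Rightarrow> nat \<Rightarrow> ('k::field, 'a set \<Rightarrow> 'k) module" where
  "cycle_space S k =
     (chain_space S k)\<lparr>carrier := {c \<in> carrier (chain_space S k). boundary k c = (\<lambda>\<tau>. 0)}\<rparr>"

definition boundaries :: "'a::linorder set set \<Rightarrow> nat \<Rightarrow> ('a set \<Rightarrow> 'k::field) set" where
  "boundaries S k = boundary (k + 1) ` carrier (chain_space S (k + 1))"

definition quotient_space :: "('k, 'v) module \<Rightarrow> 'v set \<Rightarrow> ('k, 'v set) module" where
  "quotient_space V U =
     \<lparr>carrier = a_rcosets\<^bsub>V\<^esub> U,
      mult = undefined, one = undefined,
      zero = U,
      add = set_add V,
      smult = (\<lambda>a A. \<Union>x \<in> A. U +>\<^bsub>V\<^esub> (a \<odot>\<^bsub>V\<^esub> x))\<rparr>"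

definition homology :: "'a::linorder set set \<Rightarrow> nat \<Rightarrow> ('k::field, ('a set \<Rightarrow> 'k) set) module" where
  "homology S k = quotient_space (cycle_space S k) (boundaries S k)"

text \<open>The map induced by an inclusion into \<open>T\<close>, sending the class of \<open>z\<close> to the class of \<open>z\<close>.\<close>

definition homology_inclusion ::
    "'a::linorder set set \<Rightarrow> nat \<Rightarrow> ('a set \<Rightarrow> 'k::field) set \<Rightarrow> ('a set \<Rightarrow> 'k) set" where
  "homology_inclusion T k A = (\<Union>z \<in> A. boundaries T k +>\<^bsub>cycle_space T k\<^esub> z)"

definition persistent_homology ::
    "(real \<Rightarrow> 'a::linorder set set) \<Rightarrow> nat \<Rightarrow> ('k::field, ('a set \<Rightarrow> 'k) set) pvs" where
  "persistent_homology F k =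
     \<lparr>level = (\<lambda>\<delta>. homology (F \<delta>) k),
      transition = (\<lambda>s t. homology_inclusion (F t) k)\<rparr>"


section \<open>Dowker complexes and cycle networks\<close>

definition dowker_sink :: "'a set \<Rightarrow> ('a \<Rightarrow> 'a \<Rightarrow> real) \<Rightarrow> real \<Rightarrow> 'a set set" where
  "dowker_sink X \<omega> \<delta> = {\<sigma>. \<sigma> \<noteq> {} \<and> \<sigma> \<subseteq> X \<and> (\<exists>x' \<in> X. \<forall>x \<in> \<sigma>. \<omega> x x' \<le> \<delta>)}"

text \<open>The node \<open>x\<^sub>i\<close> is represented by the natural number \<open>i\<close>.\<close>

definition cycle_nodes :: "nat \<Rightarrow> nat set" where
  "cycle_nodes n = {1..n}"

definition cycle_edges :: "nat \<Rightarrow> (nat \<times> nat) set" where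
  "cycle_edges n = {(i, i + 1) | i. 1 \<le> i \<and> i < n} \<union> {(n, 1)}"

text \<open>All edges have weight \<open>1\<close>, so the length of a path is its number of edges.\<close>

definition cycle_weight :: "nat \<Rightarrow> nat \<Rightarrow> nat \<Rightarrow> real" where
  "cycle_weight n x y = real (LEAST m. (x, y) \<in> cycle_edges n ^^ m)"

end

theory Submission
  imports Defs "HOL-Library.Function_Algebras"
begin

text \<open>
  Let \<open>P a\<close> be the path of unit edges from \<open>1\<close> to \<open>a\<close> and \<open>c\<close> the closed cycle through all nodes.  An edge
  between \<open>a < b\<close> of the sink complex at scale \<open>\<delta>\<close> satisfies \<open>b - a \<le> \<delta>\<close> or \<open>n - (b - a) \<le> \<delta>\<close>; filling
  in the arc by triangles, it is homologous to \<open>P b - P a\<close> in the first case and to \<open>P b - P a - c\<close> in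
  the second.  Hence every 1-cycle is homologous to a multiple of \<open>c\<close>.  If \<open>\<delta> \<ge> \<lceil>n/2\<rceil>\<close>, both cases
  occur for one edge and \<open>c\<close> bounds.  If \<open>\<delta> < \<lceil>n/2\<rceil>\<close>, counting the edges of the second kind is a
  cocycle with value \<open>-1\<close> on \<open>c\<close>.  As this cocycle does not depend on \<open>\<delta>\<close>, it gives an isomorphism with
  the interval module.
\<close>

subsection \<open>Persistence modules with a single interval\<close>

definition pvs_closed :: "('k, 'v) pvs \<Rightarrow> bool" where
  "pvs_closed V \<longleftrightarrow>
     (\<forall>\<delta>. \<forall>x \<in> carrier (level V \<delta>). \<forall>y \<in> carrier (level V \<delta>).
        x \<oplus>\<^bsub>level V \<delta>\<^esub> y \<in> carrier (level V \<delta>)) \<and>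
     (\<forall>\<delta> c. \<forall>x \<in> carrier (level V \<delta>). c \<odot>\<^bsub>level V \<delta>\<^esub> x \<in> carrier (level V \<delta>)) \<and>
     (\<forall>s t. s \<le> t \<longrightarrow> (\<forall>x \<in> carrier (level V s). transition V s t x \<in> carrier (level V t)))"

text \<open>
  Nothing in the definition of a persistence vector space forces closure under its operations, and
  without it the inverse of an isomorphism need not be linear or natural.
\<close>

lemma linear_iso_inv:
  assumes f: "linear_iso V W f"
    and add: "\<And>x y. x \<in> carrier V \<Longrightarrow> y \<in> carrier V \<Longrightarrow> x \<oplus>\<^bsub>V\<^esub> y \<in> carrier V"
    and smult: "\<And>c x. x \<in> carrier V \<Longrightarrow> c \<odot>\<^bsub>V\<^esub> x \<in> carrier V"
  shows "linear_iso W V (inv_into (carrier V) f)"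
proof -
  let ?g = "inv_into (carrier V) f"
  have b: "bij_betw f (carrier V) (carrier W)" using f by (simp add: linear_iso_def)
  then have gf: "?g (f x) = x" if "x \<in> carrier V" for x
    using that by (simp add: bij_betw_inv_into_left)
  have W: "carrier W = f ` carrier V" using b by (simp add: bij_betw_def)
  have "?g (f x \<oplus>\<^bsub>W\<^esub> f y) = x \<oplus>\<^bsub>V\<^esub> y" if "x \<in> carrier V" "y \<in> carrier V" for x y
    using that f gf[OF add[OF that]] by (simp add: linear_iso_def)
  moreover have "?g (c \<odot>\<^bsub>W\<^esub> f x) = c \<odot>\<^bsub>V\<^esub> x" if "x \<in> carrier V" for c x
    using that f gf[OF smult[OF that]] by (simp add: linear_iso_def)
  ultimately show ?thesis
    using bij_betw_inv_into[OF b] gf by (auto simp: linear_iso_def W)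
qed

lemma linear_iso_comp:
  assumes "linear_iso U V f" "linear_iso V W g"
  shows "linear_iso U W (g \<circ> f)"
  using assms bij_betw_trans[of f "carrier U" "carrier V" g "carrier W"]
  by (auto simp: linear_iso_def bij_betw_apply)

lemma pvs_isomorphic_sym:
  assumes "pvs_isomorphic V W" "pvs_closed V"
  shows "pvs_isomorphic W V"
proof -
  obtain \<phi> where iso: "\<And>\<delta>. linear_iso (level V \<delta>) (level W \<delta>) (\<phi> \<delta>)"
    and nat: "\<And>s t x. s \<le> t \<Longrightarrow> x \<in> carrier (level V s) \<Longrightarrow>
                \<phi> t (transition V s t x) = transition W s t (\<phi> s x)"
    using assms(1) unfolding pvs_isomorphic_def by blast
  define \<psi> where "\<psi> \<delta> = inv_into (carrier (level V \<delta>)) (\<phi> \<delta>)" for \<delta>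
  have bij: "bij_betw (\<phi> \<delta>) (carrier (level V \<delta>)) (carrier (level W \<delta>))" for \<delta>
    using iso[of \<delta>] by (simp add: linear_iso_def)
  have "linear_iso (level W \<delta>) (level V \<delta>) (\<psi> \<delta>)" for \<delta>
    unfolding \<psi>_def using iso assms(2) by (intro linear_iso_inv) (auto simp: pvs_closed_def)
  moreover have "\<psi> t (transition W s t y) = transition V s t (\<psi> s y)"
    if st: "s \<le> t" and y: "y \<in> carrier (level W s)" for s t y
  proof -
    obtain x where x: "x \<in> carrier (level V s)" "y = \<phi> s x"
      using y bij[of s] by (auto simp: bij_betw_def)
    have "transition V s t x \<in> carrier (level V t)"
      using assms(2) st x(1) by (auto simp: pvs_closed_def)
    then show ?thesis
      using nat[OF st x(1)] x bij
      by (metis \<psi>_def bij_betw_inv_into_left)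
  qed
  ultimately show ?thesis unfolding pvs_isomorphic_def by blast
qed

lemma pvs_isomorphic_trans:
  assumes "pvs_isomorphic U V" "pvs_isomorphic V W"
  shows "pvs_isomorphic U W"
proof -
  obtain \<phi> where \<phi>: "\<And>\<delta>. linear_iso (level U \<delta>) (level V \<delta>) (\<phi> \<delta>)"
    "\<And>s t x. s \<le> t \<Longrightarrow> x \<in> carrier (level U s) \<Longrightarrow>
       \<phi> t (transition U s t x) = transition V s t (\<phi> s x)"
    using assms(1) unfolding pvs_isomorphic_def by blast
  obtain \<psi> where \<psi>: "\<And>\<delta>. linear_iso (level V \<delta>) (level W \<delta>) (\<psi> \<delta>)"
    "\<And>s t x. s \<le> t \<Longrightarrow> x \<in> carrier (level V s) \<Longrightarrow>
       \<psi> t (transition V s t x) = transition W s t (\<psi> s x)"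
    using assms(2) unfolding pvs_isomorphic_def by blast
  have mem: "\<phi> \<delta> x \<in> carrier (level V \<delta>)" if "x \<in> carrier (level U \<delta>)" for \<delta> x
    using \<phi>(1)[of \<delta>] that by (auto simp: linear_iso_def dest: bij_betwE)
  have "linear_iso (level U \<delta>) (level W \<delta>) (\<psi> \<delta> \<circ> \<phi> \<delta>)" for \<delta>
    by (rule linear_iso_comp[OF \<phi>(1) \<psi>(1)])
  then show ?thesis
    unfolding pvs_isomorphic_def
    by (intro exI[of _ "\<lambda>\<delta>. \<psi> \<delta> \<circ> \<phi> \<delta>"]) (auto simp: \<phi>(2) \<psi>(2) mem)
qed

section \<open>Sums of interval modules and uniqueness of the decomposition\<close>

definition inside :: "real \<times> ereal \<Rightarrow> real \<Rightarrow> bool" where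
  "inside I \<delta> \<longleftrightarrow> fst I \<le> \<delta> \<and> ereal \<delta> < snd I"

lemma inside_fst: "ereal (fst I) < snd I \<Longrightarrow> inside I (fst I)"
  by (simp add: inside_def)

lemma level_sum_of_intervals:
  fixes Is :: "(real \<times> ereal) list"
  defines "U \<equiv> direct_sum (map interval_module Is) :: ('k::field, nat \<Rightarrow> 'k) pvs"
  shows "carrier (level U \<delta>) = (\<Pi>\<^sub>E i \<in> {..<length Is}. if inside (Is ! i) \<delta> then UNIV else {0})"
    and "x \<oplus>\<^bsub>level U \<delta>\<^esub> y = (\<lambda>i \<in> {..<length Is}. x i + y i)"
    and "c \<odot>\<^bsub>level U \<delta>\<^esub> x = (\<lambda>i \<in> {..<length Is}. c * x i)"
    and "transition U s t x =
           (\<lambda>i \<in> {..<length Is}. if inside (Is ! i) s \<and> inside (Is ! i) t then x i else 0)"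
  unfolding U_def
  by (auto simp: direct_sum_def interval_module_def inside_def Let_def restrict_def fun_eq_iff
           intro!: PiE_cong)

text \<open>If one right end were smaller than the other, it would be a real number, hence itself a
  point of the longer interval that the shorter one omits.\<close>

lemma interval_eqI:
  assumes "ereal a < b" "ereal a < b'" "\<And>\<delta>. inside (a, b) \<delta> \<longleftrightarrow> inside (a, b') \<delta>"
  shows "b = b'"
proof -
  have "\<not> d < d'" if ad: "ereal a < d" and sub: "\<And>\<delta>. inside (a, d') \<delta> \<Longrightarrow> inside (a, d) \<delta>" for d d'
  proof
    assume "d < d'"
    then obtain r where "d = ereal r" using ad by (cases d) auto
    then show False using ad sub[of r] \<open>d < d'\<close> by (simp add: inside_def)
  qed
  then show ?thesis using assms by (metis linorder_neqE)
qed

text \<open>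
  A second interval would give a level of dimension at least two at its left end point; the endpoints
  of the only interval are read off from where a generator survives.
\<close>

lemma sum_of_intervals_isomorphic_interval:
  fixes Is :: "(real \<times> ereal) list" and I :: "real \<times> ereal"
  assumes iso: "pvs_isomorphic (direct_sum (map interval_module Is) :: ('k::field, nat \<Rightarrow> 'k) pvs)
                  (direct_sum [interval_module I] :: ('k, nat \<Rightarrow> 'k) pvs)"
    and Is: "\<And>J. J \<in> set Is \<Longrightarrow> ereal (fst J) < snd J"
    and I: "ereal (fst I) < snd I"
  shows "Is = [I]"
proof -
  let ?U = "direct_sum (map interval_module Is) :: ('k, nat \<Rightarrow> 'k) pvs"
  let ?W = "direct_sum [interval_module I] :: ('k, nat \<Rightarrow> 'k) pvs"
  let ?N = "{..<length Is}"
  note U = level_sum_of_intervals[where Is = Is and 'k = 'k]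
  note W = level_sum_of_intervals[of "[I]", where 'k = 'k, unfolded list.map]
  obtain \<phi> where lin: "\<And>\<delta>. linear_iso (level ?U \<delta>) (level ?W \<delta>) (\<phi> \<delta>)"
    and nat: "\<And>s t x. s \<le> t \<Longrightarrow> x \<in> carrier (level ?U s) \<Longrightarrow>
                \<phi> t (transition ?U s t x) = transition ?W s t (\<phi> s x)"
    using iso unfolding pvs_isomorphic_def by blast
  have bij: "bij_betw (\<phi> \<delta>) (carrier (level ?U \<delta>)) (carrier (level ?W \<delta>))" for \<delta>
    using lin by (simp add: linear_iso_def)
  have inj: "x = y" if "\<phi> \<delta> x = \<phi> \<delta> y" "x \<in> carrier (level ?U \<delta>)" "y \<in> carrier (level ?U \<delta>)" for \<delta> x y
    using bij[of \<delta>] that by (auto simp: bij_betw_def inj_on_def)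
  have mem: "\<phi> \<delta> x \<in> carrier (level ?W \<delta>)" if "x \<in> carrier (level ?U \<delta>)" for \<delta> x
    using bij[of \<delta>] that by (auto dest: bij_betwE)
  have add: "\<phi> \<delta> (x \<oplus>\<^bsub>level ?U \<delta>\<^esub> y) = \<phi> \<delta> x \<oplus>\<^bsub>level ?W \<delta>\<^esub> \<phi> \<delta> y"
    if "x \<in> carrier (level ?U \<delta>)" "y \<in> carrier (level ?U \<delta>)" for \<delta> x y
    using lin[of \<delta>] that by (simp add: linear_iso_def)
  have smult: "\<phi> \<delta> (c \<odot>\<^bsub>level ?U \<delta>\<^esub> x) = c \<odot>\<^bsub>level ?W \<delta>\<^esub> \<phi> \<delta> x"
    if "x \<in> carrier (level ?U \<delta>)" for \<delta> c x
    using lin[of \<delta>] that by (simp add: linear_iso_def)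
  \<comment> \<open>The unit vector \<open>e j\<close> does not depend on the scale: the same
    function generates summand \<open>j\<close> at every level where that interval is alive, and
    transitions fix it or kill it.\<close>
  define e :: "nat \<Rightarrow> nat \<Rightarrow> 'k" where "e j = (\<lambda>i \<in> ?N. if i = j then 1 else 0)" for j
  define o\<^sub>U :: "nat \<Rightarrow> 'k" where "o\<^sub>U = (\<lambda>i \<in> ?N. 0)"
  define o\<^sub>W :: "nat \<Rightarrow> 'k" where "o\<^sub>W = (\<lambda>i \<in> {..<1}. 0)"
  have e_mem: "e j \<in> carrier (level ?U \<delta>)" if "inside (Is ! j) \<delta>" for j \<delta>
    using that by (auto simp: U e_def)
  have o_mem: "o\<^sub>U \<in> carrier (level ?U \<delta>)" for \<delta>
    by (auto simp: U o\<^sub>U_def)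
  \<comment> \<open>That zero goes to zero is not part of \<open>linear_iso\<close>; it comes from
    scaling by 0.\<close>
  have \<phi>_o: "\<phi> \<delta> o\<^sub>U = o\<^sub>W" for \<delta>
    using smult[OF o_mem, of \<delta> 0] by (simp add: U W o\<^sub>U_def o\<^sub>W_def restrict_def cong: if_cong)
  have e_neq: "e j \<noteq> o\<^sub>U" if "j < length Is" for j
    using that by (auto simp: e_def o\<^sub>U_def fun_eq_iff)
  have \<phi>_e: "\<phi> \<delta> (e j) 0 \<noteq> 0" if "j < length Is" "inside (Is ! j) \<delta>" for j \<delta>
  proof
    assume *: "\<phi> \<delta> (e j) 0 = 0"
    have "\<phi> \<delta> (e j) = o\<^sub>W"
      using mem[OF e_mem[OF that(2)]] * by (auto simp: W o\<^sub>W_def PiE_def extensional_def fun_eq_iff)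
    then show False
      using inj[OF _ e_mem[OF that(2)] o_mem] \<phi>_o e_neq[OF that(1)] by simp
  qed
  have sub: "inside I \<delta>" if "j < length Is" "inside (Is ! j) \<delta>" for j \<delta>
    using \<phi>_e[OF that] mem[OF e_mem[OF that(2)]] by (auto simp: W PiE_def Pi_def split: if_splits)
  have uniq: "j = l" if "j < length Is" "inside (Is ! j) \<delta>" "l < length Is" "inside (Is ! l) \<delta>" for j l \<delta>
  proof (rule ccontr)
    assume "j \<noteq> l"
    \<comment> \<open>The target has one coordinate, so the images of \<open>e j\<close> and
      \<open>e l\<close> are proportional. The combination \<open>x\<close> with coefficients
      \<open>q\<close> and \<open>-p\<close> maps to zero, and injectivity forces
      \<open>q = 0\<close>.\<close>
    define p where "p = \<phi> \<delta> (e j) 0"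
    define q where "q = \<phi> \<delta> (e l) 0"
    define x where "x = (q \<odot>\<^bsub>level ?U \<delta>\<^esub> e j) \<oplus>\<^bsub>level ?U \<delta>\<^esub> ((- p) \<odot>\<^bsub>level ?U \<delta>\<^esub> e l)"
    have 1: "c \<odot>\<^bsub>level ?U \<delta>\<^esub> e i \<in> carrier (level ?U \<delta>)" if "inside (Is ! i) \<delta>" for c i
      using that by (auto simp: U e_def)
    have x_mem: "x \<in> carrier (level ?U \<delta>)"
      using that by (auto simp: x_def U e_def)
    have "\<phi> \<delta> x = o\<^sub>W"
      unfolding x_def add[OF 1[OF that(2)] 1[OF that(4)]]
        smult[OF e_mem[OF that(2)]] smult[OF e_mem[OF that(4)]]
      by (auto simp: W o\<^sub>W_def p_def q_def fun_eq_iff)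
    then have "x = o\<^sub>U" using inj[OF _ x_mem o_mem] \<phi>_o by simp
    then have "x j = 0" using that by (simp add: o\<^sub>U_def)
    then have "q = 0" using that \<open>j \<noteq> l\<close> by (simp add: x_def U e_def)
    then show False using \<phi>_e[OF that(3,4)] by (simp add: q_def)
  qed
  \<comment> \<open>Otherwise the level of the sum at the left end of \<open>I\<close> is zero, but
    the level of the single interval contains 1 there.\<close>
  have "\<exists>j < length Is. inside (Is ! j) (fst I)"
  proof (rule ccontr)
    assume *: "\<not> ?thesis"
    have "(\<lambda>i \<in> {..<1}. 1) \<in> carrier (level ?W (fst I))"
      using inside_fst[OF I] by (auto simp: W)
    then obtain x where x: "x \<in> carrier (level ?U (fst I))" "\<phi> (fst I) x = (\<lambda>i \<in> {..<1}. 1)"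
      using bij[of "fst I"] by (metis (no_types, lifting) bij_betw_def imageE)
    have "x = o\<^sub>U"
      using x(1) * by (auto simp: U o\<^sub>U_def PiE_def Pi_def extensional_def fun_eq_iff)
    then have "(\<lambda>i \<in> {..<1}. 1 :: 'k) = o\<^sub>W" using x(2) \<phi>_o by simp
    then show False by (auto simp: o\<^sub>W_def fun_eq_iff split: if_splits)
  qed
  then obtain j where j: "j < length Is" "inside (Is ! j) (fst I)" by blast
  have fst_j: "fst (Is ! j) = fst I"
    using sub[OF j(1) inside_fst[OF Is]] j by (auto simp: inside_def)
  \<comment> \<open>If \<open>e j\<close> has died by scale \<open>t\<close>, naturality kills its
    image as well, although \<open>I\<close> still transports that image unchanged from its left end
    to \<open>t\<close>.\<close>
  have conv: "inside (Is ! j) t" if t: "inside I t" for t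
  proof (rule ccontr)
    assume "\<not> inside (Is ! j) t"
    then have "transition ?U (fst I) t (e j) = o\<^sub>U"
      by (auto simp: U e_def o\<^sub>U_def fun_eq_iff)
    then have "o\<^sub>W = transition ?W (fst I) t (\<phi> (fst I) (e j))"
      using nat[OF _ e_mem[OF j(2)], of t] t \<phi>_o by (simp add: inside_def)
    then have "\<phi> (fst I) (e j) 0 = 0"
      using t inside_fst[OF I] by (auto simp: W o\<^sub>W_def fun_eq_iff split: if_splits)
    then show False using \<phi>_e[OF j] by simp
  qed
  have eq: "Is ! j = I"
    using interval_eqI[of "fst I" "snd (Is ! j)" "snd I"] Is[of "Is ! j"] I sub[OF j(1)] conv fst_j j(1)
    by (metis nth_mem prod.collapse)
  \<comment> \<open>Interval \<open>l\<close> is alive at its own left end; by \<open>sub\<close>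
    and \<open>eq\<close>, interval \<open>j\<close> is alive there too, so \<open>uniq\<close>
    applies.\<close>
  have "l = j" if l: "l < length Is" for l
    using uniq[OF l _ j(1)] eq sub[OF l] inside_fst[OF Is[OF nth_mem[OF l]]] l by metis
  then have "length Is = 1" using j(1)
    by (metis One_nat_def Suc_lessI gr0I lessI less_nat_zero_code not_less_eq zero_less_Suc)
  then show ?thesis using eq j by (cases Is) auto
qed

text \<open>Any decomposition of \<open>V\<close> becomes isomorphic to the one-interval sum by
  inverting its isomorphism, which is where closure enters, and composing with the given
  one.\<close>

lemma has_persistence_diagram_single_iff:
  fixes V :: "('k::field, 'v) pvs"
  assumes iso: "pvs_isomorphic V (direct_sum [interval_module (a, b)])"
    and closed: "pvs_closed V" and "ereal a < b"
  shows "has_persistence_diagram V D \<longleftrightarrow> D = {#(a, b)#}"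
proof
  assume "has_persistence_diagram V D"
  then obtain Is where Is: "mset Is = D" "\<forall>(a, b) \<in> set Is. ereal a < b"
    "pvs_isomorphic V (direct_sum (map interval_module Is))"
    by (auto simp: has_persistence_diagram_def)
  have "Is = [(a, b)]"
    using pvs_isomorphic_trans[OF pvs_isomorphic_sym[OF Is(3) closed] iso] Is(2) assms(3)
    by (intro sum_of_intervals_isomorphic_interval) auto
  then show "D = {#(a, b)#}" using Is(1) by simp
next
  assume "D = {#(a, b)#}"
  then show "has_persistence_diagram V D"
    using assms unfolding has_persistence_diagram_def by (intro exI[of _ "[(a, b)]"]) auto
qed

subsection \<open>Simplicial chains\<close>

text \<open>Inside the vector space of all functions on sets, chains, cycles and boundaries are
  subspaces, so closure and coset arguments reduce to \<open>chain.subspace\<close>.\<close>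

interpretation chain: vector_space "\<lambda>a c \<sigma>. a * c \<sigma> :: 'k::field"
  by unfold_locales (auto simp: fun_eq_iff algebra_simps)

abbreviation chains :: "'a set set \<Rightarrow> nat \<Rightarrow> ('a set \<Rightarrow> 'k::field) set" where
  "chains S k \<equiv> carrier (chain_space S k)"

abbreviation cycles :: "'a::linorder set set \<Rightarrow> nat \<Rightarrow> ('a set \<Rightarrow> 'k::field) set" where
  "cycles S k \<equiv> carrier (cycle_space S k)"

abbreviation hclass :: "'a::linorder set set \<Rightarrow> nat \<Rightarrow> ('a set \<Rightarrow> 'k::field) \<Rightarrow> ('a set \<Rightarrow> 'k) set" where
  "hclass S k z \<equiv> boundaries S k +>\<^bsub>cycle_space S k\<^esub> z"

text \<open>Alternating sum over the facets of \<open>\<sigma>\<close>, each given by its opposite vertex.\<close>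

definition facet_sum :: "'a::linorder set \<Rightarrow> ('a \<Rightarrow> 'k::field) \<Rightarrow> 'k" where
  "facet_sum \<sigma> h = (\<Sum>v \<in> \<sigma>. (-1) ^ card {u \<in> \<sigma>. u < v} * h v)"

lemma facet_sum_pair: "a < b \<Longrightarrow> facet_sum {a, b} h = h a - h b"
proof -
  assume "a < b"
  then have "{u \<in> {a, b}. u < a} = {}" "{u \<in> {a, b}. u < b} = {a}" "a \<notin> {b}"
    by auto
  note * = this
  show ?thesis by (simp add: facet_sum_def * del: insert_iff)
qed

lemma facet_sum_triple: "a < b \<Longrightarrow> b < c \<Longrightarrow> facet_sum {a, b, c} h = h a - h b + h c"
proof -
  assume "a < b" "b < c"
  then have "{u \<in> {a, b, c}. u < a} = {}" "{u \<in> {a, b, c}. u < b} = {a}"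
    "{u \<in> {a, b, c}. u < c} = {a, b}" and "a \<notin> {b, c}" "b \<notin> {c}" "a \<notin> {b}"
    by auto
  note * = this
  show ?thesis by (simp add: facet_sum_def * del: insert_iff)
qed

text \<open>The sum in \<open>boundary\<close> runs over the support and so varies with the chain. A
  common finite index set \<open>F\<close> allows termwise comparison of different chains.\<close>

lemma boundary_eq_sum:
  assumes "finite F" "{\<sigma>. c \<sigma> \<noteq> 0} \<subseteq> F" "k \<noteq> 0"
  shows "boundary k c = (\<lambda>\<tau>. \<Sum>\<sigma> \<in> F. c \<sigma> * facet_sum \<sigma> (\<lambda>v. if \<tau> = \<sigma> - {v} then 1 else 0))"
proof
  fix \<tau>
  have "boundary k c \<tau> = (\<Sum>\<sigma> | c \<sigma> \<noteq> 0. c \<sigma> * facet_sum \<sigma> (\<lambda>v. if \<tau> = \<sigma> - {v} then 1 else 0))"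
    using assms(3) unfolding boundary_def facet_sum_def sum_distrib_left
    by (auto intro!: sum.cong)
  also have "\<dots> = (\<Sum>\<sigma> \<in> F. c \<sigma> * facet_sum \<sigma> (\<lambda>v. if \<tau> = \<sigma> - {v} then 1 else 0))"
    using assms by (intro sum.mono_neutral_left) auto
  finally show "boundary k c \<tau> = \<dots>" .
qed

lemma boundary_add:
  assumes "finite {\<sigma>. c \<sigma> \<noteq> 0}" "finite {\<sigma>. d \<sigma> \<noteq> 0}" "k \<noteq> 0"
  shows "boundary k (c + d) = boundary k c + boundary k d"
proof -
  let ?F = "{\<sigma>. c \<sigma> \<noteq> 0} \<union> {\<sigma>. d \<sigma> \<noteq> 0}"
  have "finite ?F" "{\<sigma>. (c + d) \<sigma> \<noteq> 0} \<subseteq> ?F" "{\<sigma>. c \<sigma> \<noteq> 0} \<subseteq> ?F" "{\<sigma>. d \<sigma> \<noteq> 0} \<subseteq> ?F"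
    using assms by auto
  note * = boundary_eq_sum[OF this(1) _ assms(3)]
  show ?thesis
    unfolding *[OF \<open>{\<sigma>. (c + d) \<sigma> \<noteq> 0} \<subseteq> ?F\<close>] *[OF \<open>{\<sigma>. c \<sigma> \<noteq> 0} \<subseteq> ?F\<close>] *[OF \<open>{\<sigma>. d \<sigma> \<noteq> 0} \<subseteq> ?F\<close>]
    by (simp add: fun_eq_iff algebra_simps sum.distrib)
qed

lemma boundary_scale:
  assumes "finite {\<sigma>. c \<sigma> \<noteq> 0}" "k \<noteq> 0"
  shows "boundary k (\<lambda>\<sigma>. a * c \<sigma>) = (\<lambda>\<tau>. a * boundary k c \<tau>)"
proof -
  have "{\<sigma>. a * c \<sigma> \<noteq> 0} \<subseteq> {\<sigma>. c \<sigma> \<noteq> 0}" by auto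
  from boundary_eq_sum[OF assms(1) this assms(2)] boundary_eq_sum[OF assms(1) order_refl assms(2)]
  show ?thesis by (simp add: sum_distrib_left mult.assoc)
qed

text \<open>Boundary and coboundary are adjoint: the facet sum on the right is the coboundary of the
  cochain \<open>g\<close>. The proof interchanges the two sums.\<close>

lemma sum_boundary:
  fixes c g :: "'a::linorder set \<Rightarrow> 'k::field"
  assumes "finite V" "{\<sigma>. c \<sigma> \<noteq> 0} \<subseteq> Pow V" "k \<noteq> 0"
  shows "(\<Sum>\<tau> \<in> Pow V. boundary k c \<tau> * g \<tau>) =
         (\<Sum>\<sigma> \<in> Pow V. c \<sigma> * facet_sum \<sigma> (\<lambda>v. g (\<sigma> - {v})))"
proof -
  have fin: "finite (Pow V)" using assms(1) by simp
  have facet: "(\<Sum>\<tau> \<in> Pow V. facet_sum \<sigma> (\<lambda>v. if \<tau> = \<sigma> - {v} then 1 else 0) * g \<tau>) =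
      facet_sum \<sigma> (\<lambda>v. g (\<sigma> - {v}))" if "\<sigma> \<in> Pow V" for \<sigma>
  proof -
    have "(\<Sum>\<tau> \<in> Pow V. facet_sum \<sigma> (\<lambda>v. if \<tau> = \<sigma> - {v} then 1 else 0) * g \<tau>) =
        (\<Sum>v \<in> \<sigma>. \<Sum>\<tau> \<in> Pow V. if \<tau> = \<sigma> - {v} then (-1) ^ card {u \<in> \<sigma>. u < v} * g \<tau> else 0)"
      unfolding facet_sum_def sum_distrib_right by (subst sum.swap) (auto intro!: sum.cong)
    also have "\<dots> = facet_sum \<sigma> (\<lambda>v. g (\<sigma> - {v}))"
      using that fin by (auto simp: facet_sum_def intro!: sum.cong)
    finally show ?thesis .
  qed
  have "(\<Sum>\<tau> \<in> Pow V. boundary k c \<tau> * g \<tau>) =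
      (\<Sum>\<sigma> \<in> Pow V. c \<sigma> * (\<Sum>\<tau> \<in> Pow V. facet_sum \<sigma> (\<lambda>v. if \<tau> = \<sigma> - {v} then 1 else 0) * g \<tau>))"
    unfolding boundary_eq_sum[OF fin assms(2,3)] sum_distrib_right sum_distrib_left
    by (subst sum.swap) (simp add: mult.assoc)
  also have "\<dots> = (\<Sum>\<sigma> \<in> Pow V. c \<sigma> * facet_sum \<sigma> (\<lambda>v. g (\<sigma> - {v})))"
    using facet by (auto intro!: sum.cong)
  finally show ?thesis .
qed

section \<open>Chains, cycles and boundaries as subspaces\<close>

lemma subspace_chains: "chain.subspace (chains S k :: ('a set \<Rightarrow> 'k::field) set)"
proof (rule chain.subspaceI)
  fix x y :: "'a set \<Rightarrow> 'k" assume "x \<in> chains S k" "y \<in> chains S k"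
  then have "finite ({\<sigma>. x \<sigma> \<noteq> 0} \<union> {\<sigma>. y \<sigma> \<noteq> 0})" "{\<sigma>. x \<sigma> \<noteq> 0} \<union> {\<sigma>. y \<sigma> \<noteq> 0} \<subseteq> {\<sigma> \<in> S. card \<sigma> = k + 1}"
    by (auto simp: chain_space_def)
  moreover have "{\<sigma>. (x + y) \<sigma> \<noteq> 0} \<subseteq> {\<sigma>. x \<sigma> \<noteq> 0} \<union> {\<sigma>. y \<sigma> \<noteq> 0}" by auto
  ultimately have "finite {\<sigma>. (x + y) \<sigma> \<noteq> 0}" "{\<sigma>. (x + y) \<sigma> \<noteq> 0} \<subseteq> {\<sigma> \<in> S. card \<sigma> = k + 1}"
    by (blast intro: finite_subset)+
  then show "x + y \<in> chains S k" by (simp add: chain_space_def)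
qed (auto simp: chain_space_def elim: rev_finite_subset)

lemma finite_support: "c \<in> chains S k \<Longrightarrow> finite {\<sigma>. c \<sigma> \<noteq> 0}"
  by (simp add: chain_space_def)

lemma boundary_0: "boundary k 0 = 0"
  by (simp add: boundary_def fun_eq_iff)

lemma cycles_iff: "z \<in> cycles S k \<longleftrightarrow> z \<in> chains S k \<and> boundary k z = 0"
  by (simp add: cycle_space_def zero_fun_def)

lemma subspace_cycles: "k \<noteq> 0 \<Longrightarrow> chain.subspace (cycles S k)"
  using chain.subspace_0[OF subspace_chains]
  by (intro chain.subspaceI)
    (auto simp: cycles_iff boundary_0 chain.subspace_add[OF subspace_chains]
      chain.subspace_scale[OF subspace_chains] boundary_add boundary_scale finite_support zero_fun_def[symmetric])

lemma subspace_boundaries: "chain.subspace (boundaries S k :: ('a::linorder set \<Rightarrow> 'k::field) set)"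
proof (rule chain.subspaceI)
  show "0 \<in> boundaries S k"
    unfolding boundaries_def using chain.subspace_0[OF subspace_chains]
    by (intro image_eqI[of _ _ 0]) (simp_all add: boundary_0)
next
  fix x y :: "'a set \<Rightarrow> 'k" assume "x \<in> boundaries S k" "y \<in> boundaries S k"
  then obtain c d where cd: "c \<in> chains S (k + 1)" "d \<in> chains S (k + 1)"
    "x = boundary (k + 1) c" "y = boundary (k + 1) d"
    by (auto simp: boundaries_def)
  then have "x + y = boundary (k + 1) (c + d)"
    by (simp add: boundary_add finite_support)
  then show "x + y \<in> boundaries S k"
    using chain.subspace_add[OF subspace_chains cd(1,2)] by (auto simp: boundaries_def)
next
  fix a :: 'k and x :: "'a set \<Rightarrow> 'k" assume "x \<in> boundaries S k"
  then obtain c where c: "c \<in> chains S (k + 1)" "x = boundary (k + 1) c"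
    by (auto simp: boundaries_def)
  then have "(\<lambda>\<sigma>. a * x \<sigma>) = boundary (k + 1) (\<lambda>\<sigma>. a * c \<sigma>)"
    by (simp add: boundary_scale finite_support)
  then show "(\<lambda>\<sigma>. a * x \<sigma>) \<in> boundaries S k"
    using chain.subspace_scale[OF subspace_chains c(1)] by (auto simp: boundaries_def)
qed

lemma boundaries_mono: "S \<subseteq> T \<Longrightarrow> boundaries S k \<subseteq> boundaries T k"
  unfolding boundaries_def by (intro image_mono) (auto simp: chain_space_def)

lemma cycles_mono: "S \<subseteq> T \<Longrightarrow> cycles S k \<subseteq> cycles T k"
  by (auto simp: cycle_space_def chain_space_def)

lemma add_cycle_space: "x \<oplus>\<^bsub>cycle_space S k\<^esub> y = x + y"
  by (simp add: cycle_space_def chain_space_def plus_fun_def)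

lemma smult_cycle_space: "a \<odot>\<^bsub>cycle_space S k\<^esub> x = (\<lambda>\<sigma>. a * x \<sigma>)"
  by (simp add: cycle_space_def chain_space_def)

section \<open>Homology classes as cosets\<close>

lemma mem_hclass_iff: "x \<in> hclass S k z \<longleftrightarrow> x - z \<in> boundaries S k"
  by (force simp: a_r_coset_def' add_cycle_space)

lemma hclass_self: "z \<in> hclass S k z"
  using chain.subspace_0[OF subspace_boundaries] by (simp add: mem_hclass_iff)

lemma hclass_eq_iff: "hclass S k x = hclass S k y \<longleftrightarrow> x - y \<in> boundaries S k"
proof
  assume "hclass S k x = hclass S k y"
  then show "x - y \<in> boundaries S k" using hclass_self[of x S k] by (simp add: mem_hclass_iff)
next
  assume xy: "x - y \<in> boundaries S k"
  have "u - x \<in> boundaries S k \<longleftrightarrow> u - y \<in> boundaries S k" for u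
    using chain.subspace_add[OF subspace_boundaries _ xy, of "u - x"]
      chain.subspace_diff[OF subspace_boundaries _ xy, of "u - y"] by auto
  then show "hclass S k x = hclass S k y" by (auto simp: mem_hclass_iff)
qed

lemma carrier_homology: "carrier (homology S k) = hclass S k ` cycles S k"
  by (auto simp: homology_def quotient_space_def A_RCOSETS_def')

lemma add_homology: "hclass S k x \<oplus>\<^bsub>homology S k\<^esub> hclass S k y = hclass S k (x + y)"
proof -
  have "u \<in> hclass S k (x + y) \<longleftrightarrow> (\<exists>v w. v \<in> hclass S k x \<and> w \<in> hclass S k y \<and> u = v + w)" for u
  proof
    assume "u \<in> hclass S k (x + y)"
    then have "u - y \<in> hclass S k x" by (simp add: mem_hclass_iff algebra_simps)
    then show "\<exists>v w. v \<in> hclass S k x \<and> w \<in> hclass S k y \<and> u = v + w"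
      using hclass_self by (metis diff_add_cancel)
  next
    assume "\<exists>v w. v \<in> hclass S k x \<and> w \<in> hclass S k y \<and> u = v + w"
    then obtain v w where "v - x \<in> boundaries S k" "w - y \<in> boundaries S k" "u = v + w"
      by (auto simp: mem_hclass_iff)
    then show "u \<in> hclass S k (x + y)"
      using chain.subspace_add[OF subspace_boundaries, of "v - x" S k "w - y"]
      by (simp add: mem_hclass_iff algebra_simps)
  qed
  then have "hclass S k (x + y) = (\<Union>v \<in> hclass S k x. \<Union>w \<in> hclass S k y. {v + w})" by blast
  then show ?thesis
    by (simp add: homology_def quotient_space_def set_add_def' add_cycle_space)
qed

text \<open>The scalar multiple is defined as a union over representatives. Scaled representatives
  differ by a scaled boundary, so every term of the union is the same coset.\<close>

lemma smult_homology: "a \<odot>\<^bsub>homology S k\<^esub> hclass S k x = hclass S k (\<lambda>\<sigma>. a * x \<sigma>)"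
proof -
  have "hclass S k (\<lambda>\<sigma>. a * y \<sigma>) = hclass S k (\<lambda>\<sigma>. a * x \<sigma>)" if "y \<in> hclass S k x" for y
    using chain.subspace_scale[OF subspace_boundaries that[unfolded mem_hclass_iff], of a]
    by (simp add: hclass_eq_iff fun_diff_def right_diff_distrib)
  then have "(\<Union>y \<in> hclass S k x. hclass S k (\<lambda>\<sigma>. a * y \<sigma>)) = (\<Union>y \<in> hclass S k x. hclass S k (\<lambda>\<sigma>. a * x \<sigma>))"
    by (rule SUP_cong[OF refl])
  also have "\<dots> = hclass S k (\<lambda>\<sigma>. a * x \<sigma>)" using hclass_self[of x S k] by blast
  finally show ?thesis
    by (simp add: homology_def quotient_space_def smult_cycle_space)
qed

text \<open>Again the union over representatives collapses, since a boundary in \<open>S\<close> is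
  also one in \<open>T\<close>.\<close>

lemma homology_inclusion_hclass:
  assumes "S \<subseteq> T"
  shows "homology_inclusion T k (hclass S k x) = hclass T k x"
proof -
  have "hclass T k y = hclass T k x" if "y \<in> hclass S k x" for y
    using that boundaries_mono[OF assms] by (auto simp: mem_hclass_iff hclass_eq_iff)
  then have "(\<Union>y \<in> hclass S k x. hclass T k y) = (\<Union>y \<in> hclass S k x. hclass T k x)"
    by (rule SUP_cong[OF refl])
  also have "\<dots> = hclass T k x" using hclass_self[of x S k] by blast
  finally show ?thesis by (simp add: homology_inclusion_def)
qed

lemma pvs_closed_persistent_homology:
  assumes "\<And>s t. s \<le> t \<Longrightarrow> F s \<subseteq> F t" "k \<noteq> 0"
  shows "pvs_closed (persistent_homology F k :: ('k::field, _) pvs)"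
  using chain.subspace_add[OF subspace_cycles[OF assms(2)]]
    chain.subspace_scale[OF subspace_cycles[OF assms(2)]]
    cycles_mono[OF assms(1)]
  by (fastforce simp: pvs_closed_def persistent_homology_def carrier_homology add_homology
      smult_homology homology_inclusion_hclass assms(1))

section \<open>Oriented edges and triangles\<close>

text \<open>The sign compares the direction of travel with the vertex order, and a degenerate edge
  is 0; relations between edges then hold for vertices in any order.\<close>

definition edge :: "'a::linorder \<Rightarrow> 'a \<Rightarrow> 'a set \<Rightarrow> 'k::field" where
  "edge a b = (\<lambda>\<sigma>. if \<sigma> = {a, b} then (if a < b then 1 else if b < a then -1 else 0) else 0)"

lemma edge_refl [simp]: "edge a a = 0"
  by (simp add: edge_def fun_eq_iff)

lemma edge_swap: "edge b a = - edge a b"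
  by (auto simp: edge_def fun_eq_iff insert_commute)

lemma edge_less_apply: "a < b \<Longrightarrow> edge a b \<sigma> = (if \<sigma> = {a, b} then 1 else 0)"
  by (simp add: edge_def)

lemma edge_in_chains: "{a, b} \<in> S \<Longrightarrow> edge a b \<in> chains S 1"
  by (cases "a = b") (auto simp: edge_def chain_space_def card_insert_if)

lemma boundary_edge:
  fixes a b :: "'a::linorder"
  shows "boundary 1 (edge a b) = (\<lambda>\<tau>. (if \<tau> = {b} then 1 else 0) - (if \<tau> = {a} then 1 else 0 :: 'k::field))"
proof -
  have less: "boundary 1 (edge a b) = (\<lambda>\<tau>. (if \<tau> = {b} then 1 else 0) - (if \<tau> = {a} then 1 else 0 :: 'k))"
    if "a < b" for a b :: 'a
  proof -
    have "{a, b} - {a} = {b}" "{a, b} - {b} = {a}" using that by auto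
    then show ?thesis
      using that boundary_eq_sum[of "{{a, b}}" "edge a b :: 'a set \<Rightarrow> 'k" 1]
      by (auto simp: edge_def facet_sum_pair)
  qed
  consider "a < b" | "b < a" | "a = b" by fastforce
  then show ?thesis
  proof cases
    case 2
    have "{\<sigma>. edge b a \<sigma> \<noteq> (0 :: 'k)} \<subseteq> {{b, a}}" by (auto simp: edge_def)
    then have "finite {\<sigma>. edge b a \<sigma> \<noteq> (0 :: 'k)}" by (rule finite_subset) simp
    then have "boundary 1 (edge a b :: 'a set \<Rightarrow> 'k) = (\<lambda>\<tau>. - 1 * boundary 1 (edge b a) \<tau>)"
      using boundary_scale[of "edge b a :: 'a set \<Rightarrow> 'k" 1 "-1"]
      by (simp add: edge_swap[of b a] fun_Compl_def)
    then show ?thesis using less[OF 2] by (simp add: fun_eq_iff)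
  next
    case 3
    then show ?thesis by (simp add: fun_eq_iff boundary_0)
  qed (use less in simp)
qed

text \<open>For sorted vertices this is the boundary of the 2-simplex. Cyclic permutations only
  permute the summands, odd ones change the sign, and with two equal vertices everything
  cancels.\<close>

lemma triangle_in_boundaries:
  assumes "{a, b, c} \<in> S"
  shows "edge a b + edge b c + edge c a \<in> (boundaries S 1 :: ('a::linorder set \<Rightarrow> 'k::field) set)"
proof -
  have sorted: "edge a b + edge b c + edge c a \<in> (boundaries S 1 :: ('a set \<Rightarrow> 'k) set)"
    if abc: "a < b" "b < c" "{a, b, c} \<in> S" for a b c :: 'a
  proof -
    let ?t = "(\<lambda>\<sigma>. if \<sigma> = {a, b, c} then 1 else 0) :: 'a set \<Rightarrow> 'k"
    have "?t \<in> chains S 2"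
      using abc by (auto simp: chain_space_def card_insert_if)
    moreover have "boundary 2 ?t = edge a b + edge b c + edge c a"
    proof
      fix \<tau>
      have "{\<sigma>. ?t \<sigma> \<noteq> 0} \<subseteq> {{a, b, c}}" by auto
      then have "boundary 2 ?t \<tau> = facet_sum {a, b, c} (\<lambda>v. if \<tau> = {a, b, c} - {v} then 1 else 0)"
        by (simp add: boundary_eq_sum[of "{{a, b, c}}"])
      also have "\<dots> = (if \<tau> = {b, c} then 1 else 0) - (if \<tau> = {a, c} then 1 else 0) + (if \<tau> = {a, b} then 1 else 0)"
      proof -
        have "{a, b, c} - {a} = {b, c}" "{a, b, c} - {b} = {a, c}" "{a, b, c} - {c} = {a, b}"
          using abc by auto
        then show ?thesis by (simp only: facet_sum_triple[OF abc(1,2)])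
      qed
      also have "\<dots> = (edge a b + edge b c + edge c a) \<tau>"
        using abc by (simp add: edge_swap[of c a] edge_less_apply[of a b] edge_less_apply[of b c] edge_less_apply[of a c])
      finally show "boundary 2 ?t \<tau> = (edge a b + edge b c + edge c a) \<tau>" .
    qed
    ultimately show ?thesis
      unfolding boundaries_def one_add_one by (rule rev_image_eqI[where f = "boundary 2", OF _ sym])
  qed
  have eq: "edge a b + edge b c + edge c a = - (edge c b + edge b a + edge a c :: 'a set \<Rightarrow> 'k)"
    by (simp add: edge_swap[of b a] edge_swap[of c b] edge_swap[of a c] del: edge_refl)
  note neg = chain.subspace_neg[OF subspace_boundaries]
  have perm: "{b, c, a} \<in> S" "{c, a, b} \<in> S" "{c, b, a} \<in> S" "{b, a, c} \<in> S" "{a, c, b} \<in> S"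
    using assms by (simp_all add: insert_commute)
  consider "a < b" "b < c" | "b < c" "c < a" | "c < a" "a < b" | "c < b" "b < a" | "b < a" "a < c"
    | "a < c" "c < b" | "a = b" | "b = c" | "c = a"
    by (metis linorder_neqE)
  then show ?thesis
  proof cases
    case 1 then show ?thesis using sorted assms by blast
  next
    case 2 then show ?thesis using sorted[OF _ _ perm(1)] by (simp only: add_ac)
  next
    case 3 then show ?thesis using sorted[OF _ _ perm(2)] by (simp only: add_ac)
  next
    case 4 then show ?thesis unfolding eq using sorted[OF _ _ perm(3)] by (intro neg)
  next
    case 5 then show ?thesis unfolding eq using sorted[OF _ _ perm(4)] by (intro neg) (simp only: add_ac)
  next
    case 6 then show ?thesis unfolding eq using sorted[OF _ _ perm(5)] by (intro neg) (simp only: add_ac)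
  next
    case 7
    then have "edge a b + edge b c + edge c a = (0 :: 'a set \<Rightarrow> 'k)" by (simp add: edge_swap[of c b])
    then show ?thesis by (metis chain.subspace_0 subspace_boundaries)
  next
    case 8
    then have "edge a b + edge b c + edge c a = (0 :: 'a set \<Rightarrow> 'k)" by (simp add: edge_swap[of c a])
    then show ?thesis by (metis chain.subspace_0 subspace_boundaries)
  next
    case 9
    then have "edge a b + edge b c + edge c a = (0 :: 'a set \<Rightarrow> 'k)" by (simp add: edge_swap[of b a])
    then show ?thesis by (metis chain.subspace_0 subspace_boundaries)
  qed
qed

subsection \<open>The Dowker complexes of a cycle network\<close>

lemma cycle_path_mod:
  assumes "(x, y) \<in> cycle_edges n ^^ m" "x \<in> {1..n}"
  shows "y \<in> {1..n} \<and> y mod n = (x + m) mod n"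
  using assms(1)
proof (induction m arbitrary: y)
  case (Suc m)
  then obtain w where w: "w \<in> {1..n}" "w mod n = (x + m) mod n" "(w, y) \<in> cycle_edges n"
    by (auto elim!: relpow_Suc_E)
  then have "y \<in> {1..n} \<and> y mod n = Suc w mod n"
    by (auto simp: cycle_edges_def mod_Suc)
  moreover have "Suc w mod n = (x + Suc m) mod n"
    using w(2) by (metis add_Suc_right mod_Suc_eq)
  ultimately show ?case by simp
qed (use assms(2) in auto)

lemma cycle_path_exists:
  assumes "x \<in> {1..n}" "m < n"
  shows "(x, if x + m \<le> n then x + m else x + m - n) \<in> cycle_edges n ^^ m"
  using assms(2)
proof (induction m)
  case (Suc m)
  let ?y = "if x + m \<le> n then x + m else x + m - n"
  let ?y' = "if x + Suc m \<le> n then x + Suc m else x + Suc m - n"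
  have "(?y, ?y') \<in> cycle_edges n"
    using assms(1) Suc.prems by (auto simp: cycle_edges_def)
  then show ?case using Suc by (intro relpow_Suc_I) auto
qed (use assms in auto)

text \<open>The length of any path from \<open>x\<close> to \<open>y\<close> is congruent to
  \<open>m\<close> modulo \<open>n\<close>. As \<open>m < n\<close>, no smaller length has this
  residue, and a path of length \<open>m\<close> exists.\<close>

lemma cycle_weight_eq:
  assumes "x \<in> {1..n}" "y \<in> {1..n}"
  shows "cycle_weight n x y = (if x \<le> y then real (y - x) else real (n + y - x))"
proof -
  define m where "m = (if x \<le> y then y - x else n + y - x)"
  have m: "m < n" "(if x + m \<le> n then x + m else x + m - n) = y"
    using assms by (auto simp: m_def)
  have "(LEAST m. (x, y) \<in> cycle_edges n ^^ m) = m"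
  proof (rule Least_equality)
    show "(x, y) \<in> cycle_edges n ^^ m"
      using cycle_path_exists[OF assms(1) m(1)] m(2) by simp
  next
    fix k assume "(x, y) \<in> cycle_edges n ^^ k"
    then have "(x + k) mod n = (x + m) mod n"
      using cycle_path_mod[OF _ assms(1)] cycle_path_exists[OF assms(1) m(1)] m(2) by metis
    then have "n dvd m - k" if "k < m" using mod_eq_dvd_iff_nat[of "x + k" "x + m" n] that by simp
    then show "m \<le> k" using m(1) by (auto dest!: dvd_imp_le simp flip: not_less)
  qed
  then show ?thesis by (simp add: cycle_weight_def m_def)
qed

section \<open>Simplices of the sink complex\<close>

abbreviation cycle_complex :: "nat \<Rightarrow> real \<Rightarrow> nat set set" where
  "cycle_complex n \<delta> \<equiv> dowker_sink (cycle_nodes n) (cycle_weight n) \<delta>"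

lemma cycle_complex_mono: "s \<le> t \<Longrightarrow> cycle_complex n s \<subseteq> cycle_complex n t"
  by (force simp: dowker_sink_def)

lemma cycle_complex_iff:
  "\<sigma> \<in> cycle_complex n \<delta> \<longleftrightarrow> \<sigma> \<noteq> {} \<and> \<sigma> \<subseteq> {1..n} \<and>
     (\<exists>y \<in> {1..n}. \<forall>x \<in> \<sigma>. real (if x \<le> y then y - x else n + y - x) \<le> \<delta>)"
  unfolding dowker_sink_def cycle_nodes_def mem_Collect_eq
  by (intro conj_cong refl bex_cong ball_cong) (auto simp: cycle_weight_eq subset_iff)

text \<open>Let \<open>y\<close> be a common sink. The walk from \<open>a\<close> to
  \<open>y\<close> passes \<open>b\<close>, unless \<open>a \<le> y\<close> and
  \<open>y < b\<close>; in that case the walk from \<open>b\<close> to \<open>y\<close> passes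
  \<open>a\<close>. Hence one end point reaches the other within \<delta>.\<close>

lemma cycle_complex_edge:
  assumes "{a, b} \<in> cycle_complex n \<delta>" "a < b"
  shows "real (b - a) \<le> \<delta> \<or> real (n - (b - a)) \<le> \<delta>"
proof -
  obtain y where y: "y \<in> {1..n}" "b \<in> {1..n}" "real (if a \<le> y then y - a else n + y - a) \<le> \<delta>"
    "real (if b \<le> y then y - b else n + y - b) \<le> \<delta>"
    using assms by (auto simp: cycle_complex_iff)
  have "real k \<le> \<delta>" if "k \<le> m" "real m \<le> \<delta>" for k m using that by linarith
  moreover have "b - a \<le> (if a \<le> y then y - a else n + y - a) \<or>
      n - (b - a) \<le> (if b \<le> y then y - b else n + y - b)"
    using y(1,2) assms(2) by auto
  ultimately show ?thesis using y(3,4) by blast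
qed

lemma card_2_ordered:
  assumes "card \<sigma> = 2"
  obtains a b :: "'a::linorder" where "\<sigma> = {a, b}" "a < b"
  using assms by (auto simp: card_2_iff elim: linorder_neqE) (metis insert_commute linorder_neqE)

lemma card_3_ordered:
  assumes "card \<sigma> = 3"
  obtains a b c :: "'a::linorder" where "\<sigma> = {a, b, c}" "a < b" "b < c"
proof -
  have fin: "finite \<sigma>" and "\<sigma> \<noteq> {}" using assms card.infinite by force+
  then have m: "Min \<sigma> \<in> \<sigma>" by simp
  then have "card (\<sigma> - {Min \<sigma>}) = 2" using fin assms by simp
  then obtain b c where bc: "\<sigma> - {Min \<sigma>} = {b, c}" "b < c" by (rule card_2_ordered)
  then have "Min \<sigma> < b" using fin by (metis Diff_iff Min_le insertI1 order_le_neq_trans)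
  moreover have "\<sigma> = {Min \<sigma>, b, c}" using bc(1) m by blast
  ultimately show ?thesis using that bc(2) by blast
qed

subsection \<open>The fundamental cycle and its boundaries\<close>

definition path_chain :: "nat \<Rightarrow> nat set \<Rightarrow> 'k::field" where
  "path_chain a = (\<Sum>i \<in> {1..<a}. edge i (i + 1))"

definition cycle_chain :: "nat \<Rightarrow> nat set \<Rightarrow> 'k::field" where
  "cycle_chain n = path_chain n + edge n 1"

lemma path_chain_Suc: "1 \<le> a \<Longrightarrow> path_chain (Suc a) = path_chain a + edge a (Suc a)"
  by (simp add: path_chain_def)

lemma path_chain_1 [simp]: "path_chain (Suc 0) = 0"
  by (simp add: path_chain_def)

text \<open>The arc is filled by the fan of triangles \<open>{a, i, Suc i}\<close>. All of them have
  the sink \<open>b\<close>, which every node of the arc reaches within \<delta>.\<close>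

lemma short_edge_homologous_path:
  assumes "1 \<le> a" "a \<le> b" "b \<le> n" "real (b - a) \<le> \<delta>"
  shows "edge a b - (path_chain b - path_chain a) \<in>
           (boundaries (cycle_complex n \<delta>) 1 :: (nat set \<Rightarrow> 'k::field) set)"
    (is "_ \<in> ?B")
proof -
  have "i \<le> b \<Longrightarrow> edge a i - (path_chain i - path_chain a) \<in> ?B" if "a \<le> i" for i
    using that
  proof (induction i rule: dec_induct)
    case base
    have "edge a a - (path_chain a - path_chain a) = (0 :: nat set \<Rightarrow> 'k)" by simp
    then show ?case using chain.subspace_0[OF subspace_boundaries] by metis
  next
    case (step i)
    have "real (b - i) \<le> \<delta>" "real (b - Suc i) \<le> \<delta>" using assms(4) step.hyps by linarith+
    then have "{a, i, Suc i} \<in> cycle_complex n \<delta>"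
      using assms step unfolding cycle_complex_iff by (intro conjI bexI[of _ b]) auto
    moreover have "edge a i - (path_chain i - path_chain a) \<in> ?B"
      by (rule step.IH) (use step.prems in simp)
    ultimately have "edge a i - (path_chain i - path_chain a) - (edge a i + edge i (Suc i) + edge (Suc i) a) \<in> ?B"
      by (rule chain.subspace_diff[OF subspace_boundaries _ triangle_in_boundaries, rotated])
    moreover have "edge a i - (path_chain i - path_chain a) - (edge a i + edge i (Suc i) + edge (Suc i) a) =
        (edge a (Suc i) - (path_chain (Suc i) - path_chain a) :: nat set \<Rightarrow> 'k)"
      using assms(1) step.hyps by (simp add: path_chain_Suc edge_swap[of "Suc i" a] algebra_simps)
    ultimately show ?case by metis
  qed
  then show ?thesis using assms(2) by blast
qed

text \<open>The arc from \<open>b\<close> over \<open>n\<close> and \<open>1\<close> to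
  \<open>a\<close> has the sink \<open>a\<close>. The triangles \<open>{b, n, 1}\<close> and
  \<open>{b, 1, a}\<close> trade the edge for steps \<open>b\<close> to \<open>n\<close>,
  \<open>n\<close> to \<open>1\<close> and \<open>1\<close> to \<open>a\<close>; the first and last
  are short edges. Cases such as \<open>b = n\<close> or \<open>a = 1\<close> are covered by
  degenerate edges.\<close>

lemma long_edge_homologous_path:
  assumes "1 \<le> a" "a < b" "b \<le> n" "real (n - (b - a)) \<le> \<delta>"
  shows "edge a b - (path_chain b - path_chain a) + cycle_chain n \<in>
           (boundaries (cycle_complex n \<delta>) 1 :: (nat set \<Rightarrow> 'k::field) set)"
    (is "_ \<in> ?B")
proof -
  have le: "real k \<le> \<delta>" if "k \<le> n - (b - a)" for k using that assms(4) by linarith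
  have "{b, n, 1} \<in> cycle_complex n \<delta>" "{b, 1, a} \<in> cycle_complex n \<delta>"
    using assms(1-3) unfolding cycle_complex_iff by (intro conjI bexI[of _ a]; force intro!: le)+
  from this[THEN triangle_in_boundaries]
  have T: "edge b n + edge n 1 + edge 1 b \<in> ?B" "edge b 1 + edge 1 a + edge a b \<in> ?B" .
  have E: "edge b n - (path_chain n - path_chain b) \<in> ?B" "edge 1 a - (path_chain a - path_chain 1) \<in> ?B"
    using assms by (intro short_edge_homologous_path le; simp)+
  have "(edge b n + edge n 1 + edge 1 b) + (edge b 1 + edge 1 a + edge a b)
      - (edge b n - (path_chain n - path_chain b)) - (edge 1 a - (path_chain a - path_chain 1)) \<in> ?B"
    by (rule chain.subspace_diff[OF subspace_boundaries
          chain.subspace_diff[OF subspace_boundaries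
            chain.subspace_add[OF subspace_boundaries T] E(1)] E(2)])
  then show ?thesis
    by (simp add: cycle_chain_def edge_swap[of b "Suc 0"] algebra_simps)
qed

lemma sum_fun_apply: "(\<Sum>i \<in> A. f i) x = (\<Sum>i \<in> A. f i x :: 'a::comm_monoid_add)"
  by (induction A rule: infinite_finite_induct) auto

text \<open>
  Modulo boundaries \<open>z\<close> is a sum of terms \<open>z {a, b} * (path_chain b - path_chain a)\<close>, up to a
  multiple of the fundamental cycle; these terms cancel since the boundary of \<open>z\<close> vanishes.
\<close>

lemma cycle_homologous_multiple:
  fixes w :: "nat set \<Rightarrow> 'k::field"
  assumes z: "z \<in> cycles (cycle_complex n \<delta>) 1"
    and w: "\<And>a b. a < b \<Longrightarrow> {a, b} \<in> cycle_complex n \<delta> \<Longrightarrow>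
      edge a b - (path_chain b - path_chain a) + (\<lambda>\<tau>. w {a, b} * cycle_chain n \<tau>) \<in>
        boundaries (cycle_complex n \<delta>) 1"
  shows "z + (\<lambda>\<tau>. (\<Sum>\<sigma> \<in> Pow {1..n}. z \<sigma> * w \<sigma>) * cycle_chain n \<tau>) \<in> boundaries (cycle_complex n \<delta>) 1"
    (is "?l \<in> ?B")
proof -
  have supp: "\<exists>a b. \<sigma> = {a, b} \<and> a < b \<and> {a, b} \<in> cycle_complex n \<delta>" if "z \<sigma> \<noteq> 0" for \<sigma>
  proof -
    have "card \<sigma> = 2" "\<sigma> \<in> cycle_complex n \<delta>"
      using that z by (auto simp: cycles_iff chain_space_def)
    then show ?thesis by (metis card_2_ordered)
  qed
  have Pow: "{\<sigma>. z \<sigma> \<noteq> 0} \<subseteq> Pow {1..n}"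
    using supp by (fastforce simp: cycle_complex_iff)
  \<comment> \<open>\<open>Min\<close> and \<open>Max\<close> recover the ordered end points from
    the simplex, so the relations can be summed over simplices with coefficients
    \<open>z\<close>.\<close>
  define r where "r \<sigma> = edge (Min \<sigma>) (Max \<sigma>) - (path_chain (Max \<sigma>) - path_chain (Min \<sigma>))
      + (\<lambda>\<tau>. w \<sigma> * cycle_chain n \<tau>)" for \<sigma>
  have "(\<lambda>\<tau>. z \<sigma> * r \<sigma> \<tau>) \<in> ?B" for \<sigma>
  proof (cases "z \<sigma> = 0")
    case True
    then show ?thesis using chain.subspace_0[OF subspace_boundaries] by (simp add: zero_fun_def)
  next
    case False
    then obtain a b where "\<sigma> = {a, b}" "a < b" "{a, b} \<in> cycle_complex n \<delta>" using supp by blast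
    then have "r \<sigma> \<in> ?B" using w by (simp add: r_def)
    then show ?thesis by (rule chain.subspace_scale[OF subspace_boundaries])
  qed
  then have "(\<Sum>\<sigma> \<in> Pow {1..n}. (\<lambda>\<tau>. z \<sigma> * r \<sigma> \<tau>)) \<in> ?B"
    by (intro chain.subspace_sum[OF subspace_boundaries])
  moreover have "(\<Sum>\<sigma> \<in> Pow {1..n}. (\<lambda>\<tau>. z \<sigma> * r \<sigma> \<tau>)) = ?l"
  proof
    fix \<tau>
    have "(\<Sum>\<sigma> \<in> Pow {1..n}. z \<sigma> * edge (Min \<sigma>) (Max \<sigma>) \<tau>) = (\<Sum>\<sigma> \<in> Pow {1..n}. if \<sigma> = \<tau> then z \<sigma> else 0)"
    proof (rule sum.cong)
      fix \<sigma>
      show "z \<sigma> * edge (Min \<sigma>) (Max \<sigma>) \<tau> = (if \<sigma> = \<tau> then z \<sigma> else 0)"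
      proof (cases "z \<sigma> = 0")
        case False
        then obtain a b where ab: "\<sigma> = {a, b}" "a < b" using supp by blast
        then have "Min \<sigma> = a" "Max \<sigma> = b" by simp_all
        then show ?thesis using ab by (simp add: edge_less_apply eq_commute[of \<tau>])
      qed auto
    qed simp
    also have "\<dots> = z \<tau>" using Pow by (subst sum.delta) auto
    finally have 1: "(\<Sum>\<sigma> \<in> Pow {1..n}. z \<sigma> * edge (Min \<sigma>) (Max \<sigma>) \<tau>) = z \<tau>" .
    \<comment> \<open>On the support of \<open>z\<close>, the path terms are the coboundary of the
      0-cochain \<open>g\<close>, so \<open>sum_boundary\<close> turns them into a pairing with the
      vanishing boundary of \<open>z\<close>.\<close>
    define g where "g \<rho> = (path_chain (the_elem \<rho>) \<tau> :: 'k)" for \<rho>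
    have "(\<Sum>\<sigma> \<in> Pow {1..n}. z \<sigma> * (path_chain (Max \<sigma>) \<tau> - path_chain (Min \<sigma>) \<tau>)) =
        (\<Sum>\<sigma> \<in> Pow {1..n}. z \<sigma> * facet_sum \<sigma> (\<lambda>v. g (\<sigma> - {v})))"
    proof (rule sum.cong)
      fix \<sigma>
      show "z \<sigma> * (path_chain (Max \<sigma>) \<tau> - path_chain (Min \<sigma>) \<tau>) = z \<sigma> * facet_sum \<sigma> (\<lambda>v. g (\<sigma> - {v}))"
      proof (cases "z \<sigma> = 0")
        case False
        then obtain a b where ab: "\<sigma> = {a, b}" "a < b" using supp by blast
        then have "{a, b} - {a} = {b}" "{a, b} - {b} = {a}" by auto
        then show ?thesis using ab by (simp add: facet_sum_pair g_def)
      qed simp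
    qed simp
    also have "\<dots> = (\<Sum>\<rho> \<in> Pow {1..n}. boundary 1 z \<rho> * g \<rho>)"
      using Pow by (subst sum_boundary) auto
    also have "\<dots> = 0" using z by (simp add: cycles_iff)
    finally have 2: "(\<Sum>\<sigma> \<in> Pow {1..n}. z \<sigma> * (path_chain (Max \<sigma>) \<tau> - path_chain (Min \<sigma>) \<tau>)) = 0" .
    have "(\<Sum>\<sigma> \<in> Pow {1..n}. (\<lambda>\<tau>. z \<sigma> * r \<sigma> \<tau>)) \<tau> = (\<Sum>\<sigma> \<in> Pow {1..n}. z \<sigma> * r \<sigma> \<tau>)"
      by (rule sum_fun_apply)
    also have "\<dots> = (\<Sum>\<sigma> \<in> Pow {1..n}. z \<sigma> * edge (Min \<sigma>) (Max \<sigma>) \<tau>)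
        - (\<Sum>\<sigma> \<in> Pow {1..n}. z \<sigma> * (path_chain (Max \<sigma>) \<tau> - path_chain (Min \<sigma>) \<tau>))
        + (\<Sum>\<sigma> \<in> Pow {1..n}. z \<sigma> * w \<sigma>) * cycle_chain n \<tau>"
      by (simp add: r_def algebra_simps sum.distrib sum_subtractf sum_distrib_left)
    also have "\<dots> = ?l \<tau>" unfolding 1 2 by simp
    finally show "(\<Sum>\<sigma> \<in> Pow {1..n}. (\<lambda>\<tau>. z \<sigma> * r \<sigma> \<tau>)) \<tau> = ?l \<tau>" .
  qed
  ultimately show ?thesis by simp
qed

subsection \<open>The winding cocycle\<close>

text \<open>An edge wraps around if the short way between its end points crosses the step from \<open>n\<close> to \<open>1\<close>.\<close>

definition wraps :: "nat \<Rightarrow> nat set \<Rightarrow> 'k::field" where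
  "wraps n \<sigma> = (if n < 2 * (Max \<sigma> - Min \<sigma>) then 1 else 0)"

definition winding :: "nat \<Rightarrow> (nat set \<Rightarrow> 'k::field) \<Rightarrow> 'k" where
  "winding n z = (\<Sum>\<sigma> \<in> Pow {1..n}. z \<sigma> * wraps n \<sigma>)"

lemma winding_add: "winding n (x + y) = winding n x + winding n y"
  by (simp add: winding_def algebra_simps sum.distrib)

lemma winding_scale: "winding n (\<lambda>\<sigma>. a * x \<sigma>) = a * winding n x"
  by (simp add: winding_def sum_distrib_left mult.assoc)

lemma winding_0: "winding n 0 = 0"
  by (simp add: winding_def)

lemma winding_diff: "winding n (x - y) = winding n x - winding n y"
  using winding_add[of n "x - y" y] by simp

lemma winding_edge:
  assumes ab: "a \<in> {1..n}" "b \<in> {1..n}" "a < b"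
  shows "winding n (edge a b :: nat set \<Rightarrow> 'k::field) = wraps n {a, b}"
proof -
  have "winding n (edge a b :: nat set \<Rightarrow> 'k) = (\<Sum>\<sigma> \<in> Pow {1..n}. if \<sigma> = {a, b} then wraps n \<sigma> else 0)"
    unfolding winding_def using ab by (intro sum.cong) (auto simp: edge_def)
  then show ?thesis using ab by simp
qed

text \<open>For \<open>n \<ge> 3\<close> no unit step inside the path wraps, while
  \<open>{1, n}\<close> does. The sign arises because the closing edge runs from \<open>n\<close> to
  \<open>1\<close>, against the vertex order.\<close>

lemma winding_cycle_chain:
  assumes "n \<ge> 3"
  shows "winding n (cycle_chain n :: nat set \<Rightarrow> 'k::field) = -1"
proof -
  have "winding n (path_chain a :: nat set \<Rightarrow> 'k) = 0" if "1 \<le> a" "a \<le> n" for a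
    using that
  proof (induction a rule: dec_induct)
    case (step a)
    then have "winding n (path_chain a + edge a (Suc a) :: nat set \<Rightarrow> 'k) = 0"
      using assms by (simp only: winding_add) (simp add: winding_edge wraps_def)
    then show ?case using step.hyps by (metis path_chain_Suc)
  qed (metis One_nat_def path_chain_1 winding_0)
  moreover have "winding n (edge 1 n :: nat set \<Rightarrow> 'k) = 1"
    using assms by (simp add: winding_edge wraps_def)
  ultimately show ?thesis
    using assms
    by (simp add: cycle_chain_def winding_diff edge_swap[of n "Suc 0"])
qed

text \<open>Each unit edge has its head as a sink at scale 1. The boundary of the path telescopes to
  its two ends, which the closing edge cancels.\<close>

lemma cycle_chain_in_cycles:
  assumes "n \<ge> 3" "\<delta> \<ge> 1"
  shows "(cycle_chain n :: nat set \<Rightarrow> 'k::field) \<in> cycles (cycle_complex n \<delta>) 1"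
proof -
  let ?C = "chains (cycle_complex n \<delta>) 1 :: (nat set \<Rightarrow> 'k) set"
  have edge: "edge i (Suc i) \<in> ?C" if "1 \<le> i" "i < n" for i
  proof (rule edge_in_chains)
    show "{i, Suc i} \<in> cycle_complex n \<delta>"
      using that assms unfolding cycle_complex_iff by (intro conjI bexI[of _ "Suc i"]) auto
  qed
  have P_chain: "path_chain a \<in> ?C" if "1 \<le> a" "a \<le> n" for a
    unfolding path_chain_def using that
    by (intro chain.subspace_sum[OF subspace_chains]) (use edge in auto)
  have "boundary 1 (path_chain a :: nat set \<Rightarrow> 'k) = (\<lambda>\<tau>. (if \<tau> = {a} then 1 else 0) - (if \<tau> = {1} then 1 else 0))"
    if "1 \<le> a" "a \<le> n" for a
    using that
  proof (induction a rule: dec_induct)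
    case base
    have "boundary 1 (path_chain 1 :: nat set \<Rightarrow> 'k) = 0" by (simp add: boundary_0)
    then show ?case by (metis diff_self zero_fun_apply)
  next
    case (step a)
    have "path_chain a \<in> ?C" "edge a (Suc a) \<in> ?C" using P_chain edge step by simp_all
    from this[THEN finite_support] have "boundary 1 (path_chain (Suc a) :: nat set \<Rightarrow> 'k) =
        boundary 1 (path_chain a) + boundary 1 (edge a (Suc a))"
      unfolding path_chain_Suc[OF step.hyps(1)] by (rule boundary_add) simp
    then show ?case using step by (simp add: boundary_edge[unfolded One_nat_def] fun_eq_iff)
  qed
  from this[of n] have P: "path_chain n \<in> ?C"
    "boundary 1 (path_chain n :: nat set \<Rightarrow> 'k) = (\<lambda>\<tau>. (if \<tau> = {n} then 1 else 0) - (if \<tau> = {1} then 1 else 0))"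
    using assms P_chain by auto
  have E: "edge n 1 \<in> ?C"
  proof (rule edge_in_chains)
    show "{n, 1} \<in> cycle_complex n \<delta>"
      using assms unfolding cycle_complex_iff by (intro conjI bexI[of _ 1]) auto
  qed
  show ?thesis
    using chain.subspace_add[OF subspace_chains P(1) E]
    unfolding cycles_iff cycle_chain_def boundary_add[OF finite_support[OF P(1)] finite_support[OF E] one_neq_zero] P(2) boundary_edge
    by (auto simp: fun_eq_iff)
qed

text \<open>All three vertices are less than \<open>n/2\<close> steps before \<open>y\<close>. Two
  of them wrap exactly when one is at most \<open>y\<close> and the other is greater. So either no
  pair wraps, or \<open>{a, c}\<close> and exactly one of the other two pairs do.\<close>

lemma wraps_cocycle:
  assumes half: "\<And>m. real m \<le> \<delta> \<Longrightarrow> 2 * m < n"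
    and \<sigma>: "{a, b, c} \<in> cycle_complex n \<delta>" "a < b" "b < c"
  shows "wraps n {b, c} - wraps n {a, c} + wraps n {a, b} = (0 :: 'k::field)"
proof -
  obtain y where y: "y \<in> {1..n}" "a \<in> {1..n}" "c \<in> {1..n}"
    and d: "real (if a \<le> y then y - a else n + y - a) \<le> \<delta>"
    "real (if b \<le> y then y - b else n + y - b) \<le> \<delta>"
    "real (if c \<le> y then y - c else n + y - c) \<le> \<delta>"
    using \<sigma>(1) by (auto simp: cycle_complex_iff)
  have *: "wraps n {u, v} = (if n < 2 * (v - u) then 1 else 0 :: 'k)" if "u < v" for u v
    using that by (simp add: wraps_def)
  show ?thesis
    using d[THEN half] y \<sigma>(2,3) by (simp add: * split: if_splits) linarith+
qed

text \<open>By adjointness, the winding of a boundary pairs the 2-chain with the coboundary of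
  \<open>wraps\<close>, which vanishes on every 2-simplex of the complex.\<close>

lemma winding_boundary:
  assumes half: "\<And>m. real m \<le> \<delta> \<Longrightarrow> 2 * m < n"
    and x: "x \<in> boundaries (cycle_complex n \<delta>) 1"
  shows "winding n x = (0 :: 'k::field)"
proof -
  obtain c where c: "c \<in> chains (cycle_complex n \<delta>) 2" "x = boundary 2 c"
    using x by (auto simp: boundaries_def numeral_2_eq_2)
  have supp: "\<sigma> \<in> cycle_complex n \<delta> \<and> card \<sigma> = 3" if "c \<sigma> \<noteq> 0" for \<sigma>
    using that c(1) by (auto simp: chain_space_def)
  have "c \<sigma> * facet_sum \<sigma> (\<lambda>v. wraps n (\<sigma> - {v})) = 0" for \<sigma>
  proof (cases "c \<sigma> = 0")
    case False
    then obtain u v t where uvt: "\<sigma> = {u, v, t}" "u < v" "v < t"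
      using supp card_3_ordered by metis
    then have "{u, v, t} - {u} = {v, t}" "{u, v, t} - {v} = {u, t}" "{u, v, t} - {t} = {u, v}" by auto
    moreover have "wraps n {v, t} - wraps n {u, t} + wraps n {u, v} = (0 :: 'k)"
      by (rule wraps_cocycle[OF half]) (use uvt supp[OF False] in auto)
    ultimately show ?thesis
      using uvt by (simp add: facet_sum_triple)
  qed simp
  moreover have "{\<sigma>. c \<sigma> \<noteq> 0} \<subseteq> Pow {1..n}" using supp by (auto simp: cycle_complex_iff)
  ultimately show ?thesis
    unfolding winding_def c(2) by (subst sum_boundary) (auto intro!: sum.neutral)
qed

section \<open>First homology at a single scale\<close>

text \<open>Below half the length an edge cannot be short in both directions, and
  \<open>wraps\<close> detects which case occurs. It therefore serves as the coefficient
  \<open>w\<close>.\<close>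

lemma cycle_homologous_winding:
  assumes half: "\<And>m. real m \<le> \<delta> \<Longrightarrow> 2 * m < n"
    and z: "z \<in> cycles (cycle_complex n \<delta>) 1"
  shows "z + (\<lambda>\<tau>. winding n z * cycle_chain n \<tau>) \<in>
           (boundaries (cycle_complex n \<delta>) 1 :: (nat set \<Rightarrow> 'k::field) set)"
  unfolding winding_def
proof (rule cycle_homologous_multiple[OF z])
  fix a b assume ab: "a < b" "{a, b} \<in> cycle_complex n \<delta>"
  then have "1 \<le> a" "b \<le> n" by (auto simp: cycle_complex_iff)
  have "n < 2 * (b - a)" if "real (n - (b - a)) \<le> \<delta>" using half[OF that] \<open>b \<le> n\<close> by linarith
  moreover have "\<not> n < 2 * (b - a)" if "real (b - a) \<le> \<delta>" using half[OF that] by linarith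
  ultimately show "edge a b - (path_chain b - path_chain a) + (\<lambda>\<tau>. wraps n {a, b} * cycle_chain n \<tau>)
      \<in> (boundaries (cycle_complex n \<delta>) 1 :: (nat set \<Rightarrow> 'k) set)"
    using cycle_complex_edge[OF ab(2,1)] ab(1) \<open>1 \<le> a\<close> \<open>b \<le> n\<close>
      short_edge_homologous_path[of a b n \<delta>] long_edge_homologous_path[of a b n \<delta>]
    by (auto simp: wraps_def zero_fun_def[symmetric])
qed

lemma cycle_is_boundary:
  assumes n: "n \<ge> 3" and half: "real (n - n div 2) \<le> \<delta>"
    and z: "z \<in> cycles (cycle_complex n \<delta>) 1"
  shows "z \<in> (boundaries (cycle_complex n \<delta>) 1 :: (nat set \<Rightarrow> 'k::field) set)" (is "z \<in> ?B")
proof -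
  \<comment> \<open>The node opposite to \<open>1\<close>: the two arcs between them have lengths
    \<open>n div 2\<close> and \<open>n - n div 2\<close>, both at most \<delta>. Subtracting the
    two relations leaves the fundamental cycle.\<close>
  let ?b = "n div 2 + 1"
  have "real (n div 2) \<le> \<delta>" using half by linarith
  then have "edge 1 ?b - (path_chain ?b - path_chain 1) \<in> ?B"
    using n by (intro short_edge_homologous_path) auto
  moreover have "edge 1 ?b - (path_chain ?b - path_chain 1) + cycle_chain n \<in> ?B"
    using n half by (intro long_edge_homologous_path) auto
  ultimately have cyc: "cycle_chain n \<in> ?B"
    using chain.subspace_diff[OF subspace_boundaries] by fastforce
  \<comment> \<open>As the fundamental cycle bounds, the weight 0 is admissible for both kinds of
    edges.\<close>
  have "z + (\<lambda>\<tau>. (\<Sum>\<sigma> \<in> Pow {1..n}. z \<sigma> * 0) * cycle_chain n \<tau>) \<in> ?B"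
  proof (rule cycle_homologous_multiple[OF z])
    fix a b assume ab: "a < b" "{a, b} \<in> cycle_complex n \<delta>"
    then have "1 \<le> a" "b \<le> n" by (auto simp: cycle_complex_iff)
    then have "edge a b - (path_chain b - path_chain a) \<in> ?B"
      using cycle_complex_edge[OF ab(2,1)] ab(1) short_edge_homologous_path[of a b n \<delta>]
        chain.subspace_diff[OF subspace_boundaries long_edge_homologous_path[of a b n \<delta>] cyc]
      by auto
    then show "edge a b - (path_chain b - path_chain a) + (\<lambda>\<tau>. 0 * cycle_chain n \<tau>) \<in> ?B"
      by (simp add: zero_fun_def[symmetric])
  qed
  then show ?thesis by (simp add: zero_fun_def[symmetric])
qed

text \<open>Below scale 1 there are no edges, since both arcs between distinct nodes have length at
  least 1.\<close>

lemma cycles_trivial: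
  assumes "\<delta> < 1" "z \<in> cycles (cycle_complex n \<delta>) 1"
  shows "z = 0"
proof (rule ccontr)
  assume "z \<noteq> 0"
  then obtain \<sigma> where "z \<sigma> \<noteq> 0" by (auto simp: fun_eq_iff)
  then have "card \<sigma> = 2" "\<sigma> \<in> cycle_complex n \<delta>"
    using assms(2) by (auto simp: cycles_iff chain_space_def)
  then obtain a b where ab: "a < b" "{a, b} \<in> cycle_complex n \<delta>"
    by (metis card_2_ordered)
  then have "1 \<le> a" "b \<le> n" by (auto simp: cycle_complex_iff)
  then have "b - a \<ge> 1" "n - (b - a) \<ge> 1" using ab(1) by auto
  then show False using cycle_complex_edge[OF ab(2,1)] assms(1) by linarith
qed

subsection \<open>The persistence diagram\<close>

lemma cycle_persistent_homology_isomorphic: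
  assumes n: "n \<ge> 3"
  shows "pvs_isomorphic
           (persistent_homology (cycle_complex n) 1 :: ('k::field, (nat set \<Rightarrow> 'k) set) pvs)
           (direct_sum [interval_module (1, ereal (of_int \<lceil>real n / 2\<rceil>))])"
proof -
  define I :: "real \<times> ereal" where "I = (1, ereal (of_int \<lceil>real n / 2\<rceil>))"
  let ?V = "persistent_homology (cycle_complex n) 1 :: ('k, (nat set \<Rightarrow> 'k) set) pvs"
  let ?W = "direct_sum [interval_module I] :: ('k, nat \<Rightarrow> 'k) pvs"
  let ?K = "cycle_complex n"
  note W = level_sum_of_intervals[of "[I]", where 'k = 'k, unfolded list.map]
  have ceil: "\<lceil>real n / 2\<rceil> = int (n - n div 2)"
    by (cases "even n") (auto elim!: evenE oddE simp: ceiling_eq_iff)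
  \<comment> \<open>The right end of \<open>I\<close> is an integer, so a natural number below it is
    at most one less than it, hence less than \<open>n/2\<close>.\<close>
  have half: "2 * m < n" if "inside I \<delta>" "real m \<le> \<delta>" for m \<delta>
  proof -
    have "real m < real n - real (n div 2)"
      using that by (auto simp: inside_def I_def ceil)
    then have "m + n div 2 < n" by linarith
    then show ?thesis by linarith
  qed
  \<comment> \<open>The second claim serves naturality: a scale outside \<open>I\<close> but at most
    some \<open>t\<close> inside it lies below 1, where every cycle is zero.\<close>
  have outside: "z \<in> boundaries (?K \<delta>) 1" "inside I t \<Longrightarrow> \<delta> \<le> t \<Longrightarrow> winding n z = 0"
    if "\<not> inside I \<delta>" "z \<in> cycles (?K \<delta>) 1" for \<delta> t and z :: "nat set \<Rightarrow> 'k"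
  proof -
    have *: "\<delta> < 1 \<or> real (n - n div 2) \<le> \<delta>"
      using that(1) by (auto simp: inside_def I_def ceil)
    show "z \<in> boundaries (?K \<delta>) 1"
      using *
    proof
      assume "\<delta> < 1"
      then have "z = 0" using cycles_trivial that(2) by blast
      then show ?thesis using chain.subspace_0[OF subspace_boundaries] by simp
    qed (use cycle_is_boundary[OF n] that(2) in blast)
    show "winding n z = 0" if "inside I t" "\<delta> \<le> t"
    proof -
      have "\<delta> < 1" using * that by (auto simp: inside_def I_def ceil)
      then have "z = 0" using cycles_trivial \<open>z \<in> cycles _ _\<close> by blast
      then show ?thesis by (simp add: winding_0)
    qed
  qed
  \<comment> \<open>Inside \<open>I\<close> the value is independent of the chosen representative by
    \<open>winding_boundary\<close>. The restriction to \<open>{..<1}\<close> gives the single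
    coordinate of the direct sum.\<close>
  define \<theta> :: "real \<Rightarrow> (nat set \<Rightarrow> 'k) set \<Rightarrow> nat \<Rightarrow> 'k"
    where "\<theta> \<delta> A = (\<lambda>i \<in> {..<1}. if inside I \<delta> then winding n (SOME z. z \<in> A) else 0)" for \<delta> A
  have \<theta>: "\<theta> \<delta> (hclass (?K \<delta>) 1 z) = (\<lambda>i \<in> {..<1}. if inside I \<delta> then winding n z else 0)" for \<delta> z
  proof -
    have "winding n (SOME x. x \<in> hclass (?K \<delta>) 1 z) = winding n z" if "inside I \<delta>"
    proof -
      have "(SOME x. x \<in> hclass (?K \<delta>) 1 z) - z \<in> boundaries (?K \<delta>) 1"
        using someI[of "\<lambda>x. x \<in> hclass (?K \<delta>) 1 z", OF hclass_self] by (simp add: mem_hclass_iff)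
      from winding_boundary[OF half[OF that] this] show ?thesis by (simp add: winding_diff)
    qed
    then show ?thesis by (simp add: \<theta>_def)
  qed
  have inj: "x - y \<in> boundaries (?K \<delta>) 1"
    if "x \<in> cycles (?K \<delta>) 1" "y \<in> cycles (?K \<delta>) 1"
      and eq: "\<theta> \<delta> (hclass (?K \<delta>) 1 x) = \<theta> \<delta> (hclass (?K \<delta>) 1 y)" for x y \<delta>
  proof (cases "inside I \<delta>")
    case True
    then have "winding n x = winding n y" using fun_cong[OF eq[unfolded \<theta>], of 0] by simp
    then show ?thesis
      using chain.subspace_diff[OF subspace_boundaries cycle_homologous_winding[OF half[OF True] that(1)]
          cycle_homologous_winding[OF half[OF True] that(2)]] by simp
  next
    case False
    then show ?thesis using outside(1) that(1,2) chain.subspace_diff[OF subspace_boundaries] by blast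
  qed
  have "bij_betw (\<theta> \<delta>) (carrier (level ?V \<delta>)) (carrier (level ?W \<delta>))" for \<delta>
    unfolding bij_betw_def
  proof (intro conjI subset_antisym subsetI)
    show "inj_on (\<theta> \<delta>) (carrier (level ?V \<delta>))"
      using inj by (auto simp: inj_on_def persistent_homology_def carrier_homology hclass_eq_iff)
    show "f \<in> carrier (level ?W \<delta>)" if "f \<in> \<theta> \<delta> ` carrier (level ?V \<delta>)" for f
      using that by (auto simp: persistent_homology_def carrier_homology \<theta>[unfolded One_nat_def] W split: if_splits)
    show "f \<in> \<theta> \<delta> ` carrier (level ?V \<delta>)" if f: "f \<in> carrier (level ?W \<delta>)" for f
    proof -
      \<comment> \<open>The factor \<open>- f 0\<close> compensates for the winding number
        \<open>-1\<close> of the fundamental cycle.\<close>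
      define z where "z = (if inside I \<delta> then \<lambda>\<tau>. - f 0 * cycle_chain n \<tau> else 0)"
      have "z \<in> cycles (?K \<delta>) 1"
        using chain.subspace_0[OF subspace_cycles]
          chain.subspace_scale[OF subspace_cycles cycle_chain_in_cycles[OF n], of \<delta> "- f 0"]
        by (auto simp: z_def inside_def I_def)
      moreover have "f = \<theta> \<delta> (hclass (?K \<delta>) 1 z)"
        using f n winding_scale[of n "- f 0" "cycle_chain n"]
        by (auto simp: \<theta>[unfolded One_nat_def] W z_def winding_cycle_chain PiE_def Pi_def extensional_def fun_eq_iff split: if_splits)
      ultimately show ?thesis by (auto simp: persistent_homology_def carrier_homology)
    qed
  qed
  then have "linear_iso (level ?V \<delta>) (level ?W \<delta>) (\<theta> \<delta>)" for \<delta>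
    by (auto simp: linear_iso_def persistent_homology_def carrier_homology add_homology smult_homology
        \<theta>[unfolded One_nat_def] W winding_add winding_scale fun_eq_iff)
  moreover have "\<theta> t (transition ?V s t A) = transition ?W s t (\<theta> s A)"
    if st: "s \<le> t" and A: "A \<in> carrier (level ?V s)" for s t A
  proof -
    obtain z where z: "A = hclass (?K s) 1 z" "z \<in> cycles (?K s) 1"
      using A by (auto simp: persistent_homology_def carrier_homology)
    have "\<theta> t (transition ?V s t A) = \<theta> t (hclass (?K t) 1 z)"
      by (simp add: persistent_homology_def z(1) homology_inclusion_hclass[OF cycle_complex_mono[OF st]])
    \<comment> \<open>The only critical case is \<open>t\<close> inside and \<open>s\<close> outside
      \<open>I\<close>: the right side is 0 and the winding number of \<open>z\<close> vanishes by
      \<open>outside\<close>.\<close>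
    also have "\<dots> = transition ?W s t (\<theta> s A)"
      using outside(2)[OF _ z(2), of t] st by (auto simp: z(1) \<theta>[unfolded One_nat_def] W fun_eq_iff)
    finally show ?thesis .
  qed
  ultimately show ?thesis unfolding pvs_isomorphic_def I_def by blast
qed

theorem theorem33:
  fixes n :: nat
    and D :: "(real \<times> ereal) multiset"
  assumes "n \<ge> 3"
  shows "has_persistence_diagram
           (persistent_homology (dowker_sink (cycle_nodes n) (cycle_weight n)) 1
              :: ('k::field, (nat set \<Rightarrow> 'k) set) pvs) D
         \<longleftrightarrow> D = {#(1, ereal (of_int \<lceil>real n / 2\<rceil>))#}"
proof (rule has_persistence_diagram_single_iff[OF cycle_persistent_homology_isomorphic[OF assms]])
  show "pvs_closed (persistent_homology (cycle_complex n) 1 :: ('k, (nat set \<Rightarrow> 'k) set) pvs)"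
    by (intro pvs_closed_persistent_homology cycle_complex_mono) auto
  \<comment> \<open>The interval is nonempty since \<open>n \<ge> 3\<close> gives
    \<open>n/2 > 1\<close>.\<close>
  show "ereal 1 < ereal (of_int \<lceil>real n / 2\<rceil>)"
    using assms by (simp add: less_ceiling_iff)
qed

end
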